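(* Let $\alpha,\beta$ be parameters, $n\ge 1$, $x_1,\dots,x_n$ variables and $\lambda$ a partition. Then $$G^{(\alpha,\beta)}_\lambda(x_1,\dots,x_n)=Z_\lambda(x_1,\dots,x_n)=Z^{*}_\lambda(x_1,\dots,x_n),$$ where $Z_\lambda$ and $Z^*_\lambda$ are the lattice partition functions defined in the context.
   Context: Canonical Grothendieck polynomials. For partitions $\mu\subseteq\lambda$, $\lambda/\mu$ is a horizontal strip if $\lambda_1\ge\mu_1\ge\lambda_2\ge\mu_2\ge\cdots$. For a partition $\lambda$ put $\bar\lambda=(\lambda_2,\lambda_3,\dots)$, and for a skew shape $\kappa/\nu$ let $r(\kappa/\nu)$ be the number of indices $i$ with $\kappa_i>\nu_i$. The canonical Grothendieck polynomials $G^{(\alpha,\beta)}_\lambda$ are determined by: with no variables, $G^{(\alpha,\beta)}_\lambda()=1$ if $\lambda=\emptyset$ and $0$ otherwise; and $$G^{(\alpha,\beta)}_\lambda(x_1,\dots,x_{n+1})=\sum_{\mu:\ \lambda/\mu\text{ horizontal strip}}G^{(\alpha,\beta)}_\mu(x_1,\dots,x_n)\Big(\tfrac{x}{1-\alpha x}\Big)^{|\lambda|-|\mu|}\Big(\tfrac{1+\beta x}{1-\alpha x}\Big)^{r(\mu/\bar\lambda)},\quad x=x_{n+1}.$$ Lattice conventions. A vertex has left label $a$, bottom label $b$, right label $c$, top label $d$; its weight is $0$ unless $a+b=c+d$. A row with parameter $x$ is a sequence of vertices at sites $j=1,2,3,\dots$, the right label at site $j$ being the left label at site $j+1$; vertical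 labels are nonnegative integers; the left label at site $1$ (left boundary) is free, i.e. summed over all allowed values, and the right labels must be eventually equal to a prescribed right boundary value. A stack of rows $1,\dots,n$ (numbered from bottom to top) identifies the top labels of row $k$ with the bottom labels of row $k+1$; the bottom labels of row $1$ and the top labels of row $n$ are prescribed. The partition function is the sum over all labelings of the non-prescribed edges of the product of the vertex weights (all but finitely many vertices have weight $1$). For a partition $\lambda$ let $m_j(\lambda)$ be the number of parts of $\lambda$ equal to $j$. $Z_\lambda(x_1,\dots,x_n)$: horizontal labels in $\{0,1\}$; weights $w_x(a,b;c,d)=1$ if $a=b=c=d=0$; $=\frac{x}{1-\alpha x}$ if $a=1$; $=\frac{1+\beta x}{1-\alpha x}$ if $a=0$ and $(b,c,d)\neq(0,0,0)$ (subject to conservation); row $k$ has parameter $x_k$; bottom boundary all $0$; top boundary $(m_j(\lambda))_{j\ge1}$; right boundary value $0$. $Z^*_\lambda(x_1,\dots,x_n)$: horizontal labels in $\{0,1\}$; weights $w^*_x(a,b;c,d)=1$ if $(a,b,c,d)=(1,0,1,0)$; $=\frac{1+\beta x}{1-\alpha x}$ if $a=1$ and $(b,c,d)\ne(0,1,0)$; $=\frac{x}{1-\alpha x}$ if $a=0$ (subject to conservation); row $k$ (from the bottom) has parameter $x_{n+1-k}$; bottom boundary $(m_j(\lambda))_{j\ge1}$; top boundary all $0$; right boundary value $1$. *)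

theory Defs
  imports Main "HOL-Library.FuncSet"
begin

text \<open>
  Partitions are weakly decreasing, finitely supported sequences of naturals. They are indexed
  from 0: the part usually written \<open>\<lambda>\<^sub>i\<close> (with \<open>i \<ge> 1\<close>) is \<open>l (i - 1)\<close>.
\<close>

definition is_partition :: "(nat \<Rightarrow> nat) \<Rightarrow> bool" where
  "is_partition l \<longleftrightarrow> antimono l \<and> finite {i. l i \<noteq> 0}"

definition psize :: "(nat \<Rightarrow> nat) \<Rightarrow> nat" where
  "psize l = (\<Sum>i | l i \<noteq> 0. l i)"

definition bar :: "(nat \<Rightarrow> nat) \<Rightarrow> (nat \<Rightarrow> nat)" where
  "bar l = (\<lambda>i. l (Suc i))"

text \<open>The number of parts equal to \<open>j\<close>; only meaningful for \<open>j \<ge> 1\<close>.\<close>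

definition part_mult :: "(nat \<Rightarrow> nat) \<Rightarrow> nat \<Rightarrow> nat" where
  "part_mult l j = card {i. l i = j}"

definition horizontal_strip :: "(nat \<Rightarrow> nat) \<Rightarrow> (nat \<Rightarrow> nat) \<Rightarrow> bool" where
  "horizontal_strip l m \<longleftrightarrow> (\<forall>i. m i \<le> l i \<and> l (Suc i) \<le> m i)"

definition nonempty_rows :: "(nat \<Rightarrow> nat) \<Rightarrow> (nat \<Rightarrow> nat) \<Rightarrow> nat" where
  "nonempty_rows k m = card {i. m i < k i}"

text \<open>
  \<open>grothendieck \<alpha> \<beta> x n l\<close> is the canonical Grothendieck polynomial of \<open>l\<close> in the \<open>n\<close> variables
  \<open>x 1, \<dots>, x n\<close>. For a partition \<open>l\<close> only finitely many \<open>m\<close> occur in the sum.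
\<close>

primrec grothendieck ::
  "'a::field \<Rightarrow> 'a \<Rightarrow> (nat \<Rightarrow> 'a) \<Rightarrow> nat \<Rightarrow> (nat \<Rightarrow> nat) \<Rightarrow> 'a" where
  "grothendieck \<alpha> \<beta> x 0 l = (if l = (\<lambda>_. 0) then 1 else 0)"
| "grothendieck \<alpha> \<beta> x (Suc n) l =
     (\<Sum>m | is_partition m \<and> horizontal_strip l m.
        grothendieck \<alpha> \<beta> x n m
        * (x (Suc n) / (1 - \<alpha> * x (Suc n))) ^ (psize l - psize m)
        * ((1 + \<beta> * x (Suc n)) / (1 - \<alpha> * x (Suc n))) ^ nonempty_rows m (bar l))"

text \<open>
  Vertex weights, with arguments in the order left, bottom, right, top. Horizontal labels are
  restricted to \<open>{0, 1}\<close> in \<open>labelings\<close> below, so the last case is \<open>a = 0\<close>.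
\<close>

definition vertex_weight ::
  "'a::field \<Rightarrow> 'a \<Rightarrow> 'a \<Rightarrow> nat \<Rightarrow> nat \<Rightarrow> nat \<Rightarrow> nat \<Rightarrow> 'a" where
  "vertex_weight \<alpha> \<beta> x a b c d =
     (if a + b \<noteq> c + d then 0
      else if (a, b, c, d) = (0, 0, 0, 0) then 1
      else if a = 1 then x / (1 - \<alpha> * x)
      else (1 + \<beta> * x) / (1 - \<alpha> * x))"

definition dual_vertex_weight ::
  "'a::field \<Rightarrow> 'a \<Rightarrow> 'a \<Rightarrow> nat \<Rightarrow> nat \<Rightarrow> nat \<Rightarrow> nat \<Rightarrow> 'a" where
  "dual_vertex_weight \<alpha> \<beta> x a b c d =
     (if a + b \<noteq> c + d then 0
      else if (a, b, c, d) = (1, 0, 1, 0) then 1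
      else if a = 1 then (1 + \<beta> * x) / (1 - \<alpha> * x)
      else x / (1 - \<alpha> * x))"

text \<open>
  Edge labelings of a stack of \<open>n\<close> rows over the sites \<open>j = 1, 2, \<dots>\<close>. Here \<open>h k 0\<close> is the left
  boundary label of row \<open>k\<close> and \<open>h k j\<close> the right label of site \<open>j\<close>; \<open>v 0 j\<close> is the bottom label
  of row 1 at site \<open>j\<close> and \<open>v k j\<close> the top label of row \<open>k\<close>. Extensional function spaces ensure
  that every labeling is represented by exactly one pair.
\<close>

definition labelings ::
  "nat \<Rightarrow> (nat \<Rightarrow> nat) \<Rightarrow> (nat \<Rightarrow> nat) \<Rightarrow> nat \<Rightarrow> ((nat \<Rightarrow> nat \<Rightarrow> nat) \<times> (nat \<Rightarrow> nat \<Rightarrow> nat)) set" where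
  "labelings n bot_bd top_bd right_bd =
     {(h, v). h \<in> {1..n} \<rightarrow>\<^sub>E (UNIV \<rightarrow> {0, 1}) \<and> v \<in> {0..n} \<rightarrow>\<^sub>E ({1..} \<rightarrow>\<^sub>E UNIV) \<and>
        (\<forall>j\<ge>1. v 0 j = bot_bd j) \<and> (\<forall>j\<ge>1. v n j = top_bd j) \<and>
        (\<forall>k\<in>{1..n}. \<exists>J. \<forall>j\<ge>J. h k j = right_bd)}"

text \<open>
  The product of the weights of all vertices, row \<open>k\<close> having parameter \<open>y k\<close>. Infinitely many
  factors different from 1 arise (for the two models below) only if conservation fails at some
  vertex, i.e. if some factor is 0; hence the value 0 in that case.
\<close>

definition labeling_weight ::
  "('a::field \<Rightarrow> nat \<Rightarrow> nat \<Rightarrow> nat \<Rightarrow> nat \<Rightarrow> 'a) \<Rightarrow> (nat \<Rightarrow> 'a) \<Rightarrow> nat \<Rightarrow>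
   (nat \<Rightarrow> nat \<Rightarrow> nat) \<times> (nat \<Rightarrow> nat \<Rightarrow> nat) \<Rightarrow> 'a" where
  "labeling_weight w y n = (\<lambda>(h, v).
     let wt = (\<lambda>(k, j). w (y k) (h k (j - 1)) (v (k - 1) j) (h k j) (v k j));
         S = {p \<in> {1..n} \<times> {1..}. wt p \<noteq> 1}
     in if finite S then (\<Prod>p\<in>S. wt p) else 0)"

text \<open>
  The sum over all labelings is taken over those of nonzero weight; for the two models below
  there are only finitely many of these.
\<close>

definition partition_function ::
  "('a::field \<Rightarrow> nat \<Rightarrow> nat \<Rightarrow> nat \<Rightarrow> nat \<Rightarrow> 'a) \<Rightarrow> (nat \<Rightarrow> 'a) \<Rightarrow> nat \<Rightarrow>
   (nat \<Rightarrow> nat) \<Rightarrow> (nat \<Rightarrow> nat) \<Rightarrow> nat \<Rightarrow> 'a" where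
  "partition_function w y n bot_bd top_bd right_bd =
     (\<Sum>s | s \<in> labelings n bot_bd top_bd right_bd \<and> labeling_weight w y n s \<noteq> 0.
        labeling_weight w y n s)"

definition lattice_Z :: "'a::field \<Rightarrow> 'a \<Rightarrow> (nat \<Rightarrow> 'a) \<Rightarrow> nat \<Rightarrow> (nat \<Rightarrow> nat) \<Rightarrow> 'a" where
  "lattice_Z \<alpha> \<beta> x n l = partition_function (vertex_weight \<alpha> \<beta>) x n (\<lambda>_. 0) (part_mult l) 0"

definition lattice_Z_dual :: "'a::field \<Rightarrow> 'a \<Rightarrow> (nat \<Rightarrow> 'a) \<Rightarrow> nat \<Rightarrow> (nat \<Rightarrow> nat) \<Rightarrow> 'a" where
  "lattice_Z_dual \<alpha> \<beta> x n l =
     partition_function (dual_vertex_weight \<alpha> \<beta>) (\<lambda>k. x (n + 1 - k)) n (part_mult l) (\<lambda>_. 0) 1"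

end

theory Submission
  imports Defs
begin

text \<open>
  In the model for \<open>Z\<close>, conservation and the right boundary value 0 force the left label at site \<open>j\<close>
  of a row with bottom \<open>m(\<mu>)\<close> and top \<open>m(\<lambda>)\<close> to be \<open>\<lambda>'\<^sub>j - \<mu>'\<^sub>j\<close>, where primes denote conjugate
  partitions. These labels lie in \<open>{0, 1}\<close> exactly if \<open>\<lambda>/\<mu>\<close> is a horizontal strip, \<open>|\<lambda>| - |\<mu>|\<close> of
  them are 1, and the sites with left label 0 and a nonzero bottom label are the \<open>\<mu>\<^sub>i\<close> with
  \<open>\<mu>\<^sub>i > \<lambda>\<^sub>i\<^sub>+\<^sub>1\<close>. So splitting off the top row of the lattice is the branching rule for \<open>G\<close>.
  Replacing every horizontal label \<open>a\<close> by \<open>1 - a\<close> and turning the lattice upside down exchanges the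
  two models.
\<close>

subsection \<open>Conjugate partitions\<close>

text \<open>Columns are indexed from 0, so the column met at site \<open>j\<close> is
  \<open>conjugate l (j - 1)\<close>.\<close>

definition conjugate :: "(nat \<Rightarrow> nat) \<Rightarrow> nat \<Rightarrow> nat" where
  "conjugate l j = card {i. j < l i}"

lemma is_partition_antimonoD: "is_partition l \<Longrightarrow> i \<le> k \<Longrightarrow> l k \<le> l i"
  by (auto simp: is_partition_def antimono_def)

lemma finite_parts_greater: "is_partition l \<Longrightarrow> finite {i. j < l i}"
  by (rule finite_subset[of _ "{i. l i \<noteq> 0}"]) (auto simp: is_partition_def)

text \<open>As \<open>l\<close> decreases, this finite set is closed downward, hence an initial
  segment; it ends at the least index outside it.\<close>

lemma parts_greater_eq:
  assumes "is_partition l"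
  shows "{i. j < l i} = {..<conjugate l j}"
proof -
  let ?A = "{i. j < l i}"
  have fin: "finite ?A" by (rule finite_parts_greater[OF assms])
  have "\<exists>i. i \<notin> ?A" using fin infinite_UNIV_nat by (metis UNIV_eq_I)
  define n where "n = (LEAST i. i \<notin> ?A)"
  have n: "n \<notin> ?A" unfolding n_def using \<open>\<exists>i. i \<notin> ?A\<close> by (rule LeastI_ex)
  have less: "i \<in> ?A" if "i < n" for i using that not_less_Least unfolding n_def by blast
  have "?A = {..<n}"
  proof (intro set_eqI iffI)
    fix i assume "i \<in> ?A"
    then have "\<not> n \<le> i" using n is_partition_antimonoD[OF assms, of n i] by auto
    then show "i \<in> {..<n}" by auto
  qed (use less in auto)
  then show ?thesis by (simp add: conjugate_def)
qed

text \<open>Both sides say that the cell in row \<open>i\<close> and column \<open>j\<close> lies in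
  the diagram of \<open>l\<close>.\<close>

lemma less_conjugate_iff: "is_partition l \<Longrightarrow> i < conjugate l j \<longleftrightarrow> j < l i"
  using parts_greater_eq[of l j] by (auto simp: set_eq_iff)

lemma conjugate_conjugate: "is_partition l \<Longrightarrow> conjugate (conjugate l) = l"
  by (rule ext) (simp add: conjugate_def[of "conjugate l"] less_conjugate_iff flip: lessThan_def)

lemma conjugate_inject: "is_partition l \<Longrightarrow> is_partition m \<Longrightarrow> conjugate l = conjugate m \<Longrightarrow> l = m"
  using conjugate_conjugate by metis

lemma conjugate_eq_0: "is_partition l \<Longrightarrow> l 0 \<le> j \<Longrightarrow> conjugate l j = 0"
  using less_conjugate_iff[of l 0 j] by simp

lemma is_partition_conjugate:
  assumes "is_partition l"
  shows "is_partition (conjugate l)"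
proof -
  have "antimono (conjugate l)"
    unfolding conjugate_def antimono_def
    by (intro allI impI card_mono finite_parts_greater[OF assms]) auto
  moreover have "{j. conjugate l j \<noteq> 0} \<subseteq> {..<l 0}"
  proof
    fix j assume "j \<in> {j. conjugate l j \<noteq> 0}"
    then show "j \<in> {..<l 0}" using conjugate_eq_0[OF assms, of j] by (cases "j < l 0") auto
  qed
  ultimately show ?thesis unfolding is_partition_def using finite_subset finite_lessThan by blast
qed

text \<open>A part exceeding \<open>j\<close> equals \<open>Suc j\<close> or exceeds it. So the
  multiplicities, which are the vertical labels, are successive differences of column
  lengths.\<close>

lemma conjugate_eq_part_mult_plus:
  assumes "is_partition l"
  shows "conjugate l j = part_mult l (Suc j) + conjugate l (Suc j)"
proof -
  have "{i. j < l i} = {i. l i = Suc j} \<union> {i. Suc j < l i}" by auto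
  moreover have "finite {i. l i = Suc j}"
    by (rule finite_subset[OF _ finite_parts_greater[OF assms, of j]]) auto
  ultimately show ?thesis
    unfolding conjugate_def part_mult_def
    using finite_parts_greater[OF assms, of "Suc j"] by (subst card_Un_disjoint[symmetric]) auto
qed

lemma part_mult_eq_0: "is_partition l \<Longrightarrow> l 0 \<le> j \<Longrightarrow> part_mult l (Suc j) = 0"
  using conjugate_eq_part_mult_plus[of l j] conjugate_eq_0[of l j] by simp

section \<open>Size, horizontal strips and nonempty rows in terms of columns\<close>

lemma psize_eq_sum_conjugate:
  assumes "is_partition l" "l 0 \<le> N"
  shows "psize l = (\<Sum>j<N. conjugate l j)"
proof -
  have fin: "finite {i. l i \<noteq> 0}" using assms(1) by (simp add: is_partition_def)
  have "psize l = card (SIGMA i:{i. l i \<noteq> 0}. {..<l i})"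
    using fin by (simp add: psize_def)
  also have "\<dots> = card (SIGMA j:{..<N}. {i. j < l i})"
  \<comment> \<open>Transposing cells turns a count by rows into a count by columns; the columns
    from \<open>N\<close> on are empty.\<close>
  proof (rule bij_betw_same_card[of "\<lambda>(i, j). (j, i)"], rule bij_betw_byWitness[where f' = "\<lambda>(j, i). (i, j)"])
    have "l i \<le> N" for i using is_partition_antimonoD[OF assms(1), of 0 i] assms(2) by simp
    then show "(\<lambda>(i, j). (j, i)) ` (SIGMA i:{i. l i \<noteq> 0}. {..<l i}) \<subseteq> (SIGMA j:{..<N}. {i. j < l i})"
      by (auto intro: less_le_trans)
  qed auto
  also have "\<dots> = (\<Sum>j<N. conjugate l j)"
    using finite_parts_greater[OF assms(1)] by (subst card_SigmaI) (auto simp: conjugate_def)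
  finally show ?thesis .
qed

text \<open>Each inequality is spelled out as an implication between strict ones; in that form
  \<open>less_conjugate_iff\<close> exchanges rows and columns.\<close>

lemma horizontal_strip_iff_conjugate:
  assumes "is_partition l" "is_partition m"
  shows "horizontal_strip l m \<longleftrightarrow>
    (\<forall>j. conjugate m j \<le> conjugate l j \<and> conjugate l j \<le> Suc (conjugate m j))"
proof -
  have le_iff: "a \<le> b \<longleftrightarrow> (\<forall>j. j < a \<longrightarrow> j < b)" for a b :: nat
    using lessThan_subset_iff[of a b] by (simp only: subset_iff lessThan_iff)
  have le_Suc_iff: "a \<le> Suc b \<longleftrightarrow> (\<forall>j. Suc j < a \<longrightarrow> j < b)" for a b :: nat
    using le_iff[of "a - 1" b] by (simp add: less_diff_conv le_diff_conv)
  have "(\<forall>i. m i \<le> l i) \<longleftrightarrow> (\<forall>i j. i < conjugate m j \<longrightarrow> i < conjugate l j)"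
    unfolding le_iff[of "m _"] using assms by (simp only: less_conjugate_iff)
  then have 1: "(\<forall>i. m i \<le> l i) \<longleftrightarrow> (\<forall>j. conjugate m j \<le> conjugate l j)"
    unfolding le_iff[of "conjugate m _"] by blast
  have "(\<forall>i. l (Suc i) \<le> m i) \<longleftrightarrow> (\<forall>i j. Suc i < conjugate l j \<longrightarrow> i < conjugate m j)"
    unfolding le_iff[of "l (Suc _)"] using assms by (simp only: less_conjugate_iff)
  then have "(\<forall>i. l (Suc i) \<le> m i) \<longleftrightarrow> (\<forall>j. conjugate l j \<le> Suc (conjugate m j))"
    unfolding le_Suc_iff by blast
  with 1 show ?thesis unfolding horizontal_strip_def by blast
qed

lemma finite_horizontal_strips:
  assumes "is_partition l"
  shows "finite {m. is_partition m \<and> horizontal_strip l m}"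
proof -
  have le: "l i \<le> l 0" for i using is_partition_antimonoD[OF assms, of 0 i] by simp
  have "finite {m. \<forall>i. (i \<in> {i. l i \<noteq> 0} \<longrightarrow> m i \<in> {..l 0}) \<and> (i \<notin> {i. l i \<noteq> 0} \<longrightarrow> m i = 0)}"
    using assms by (intro finite_set_of_finite_funs) (auto simp: is_partition_def)
  moreover have "{m. is_partition m \<and> horizontal_strip l m} \<subseteq>
      {m. \<forall>i. (i \<in> {i. l i \<noteq> 0} \<longrightarrow> m i \<in> {..l 0}) \<and> (i \<notin> {i. l i \<noteq> 0} \<longrightarrow> m i = 0)}"
  proof clarify
    fix m i assume "horizontal_strip l m"
    then have "m i \<le> l i" by (simp add: horizontal_strip_def)
    then show "(i \<in> {i. l i \<noteq> 0} \<longrightarrow> m i \<in> {..l 0}) \<and> (i \<notin> {i. l i \<noteq> 0} \<longrightarrow> m i = 0)"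
      using le[of i] by auto
  qed
  ultimately show ?thesis by (rule rev_finite_subset)
qed

text \<open>A column of a horizontal strip has at most one cell, so counting cells is counting
  nonempty columns.\<close>

lemma psize_diff_horizontal_strip:
  assumes "is_partition l" "is_partition m" "horizontal_strip l m" "l 0 \<le> N"
  shows "psize l - psize m = card {j \<in> {1..N}. conjugate l (j - 1) - conjugate m (j - 1) = 1}"
proof -
  have *: "conjugate m j \<le> conjugate l j" "conjugate l j \<le> Suc (conjugate m j)" for j
    using assms horizontal_strip_iff_conjugate by auto
  have "m 0 \<le> N" using assms by (auto simp: horizontal_strip_def intro: le_trans)
  then have "psize l - psize m = (\<Sum>j<N. conjugate l j - conjugate m j)"
    using assms * by (simp add: psize_eq_sum_conjugate sum_subtractf_nat)
  also have "\<dots> = (\<Sum>j<N. if conjugate l j - conjugate m j = 1 then 1 else 0)"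
  proof (rule sum.cong)
    fix j
    show "conjugate l j - conjugate m j = (if conjugate l j - conjugate m j = 1 then 1 else 0)"
      using *[of j] by auto
  qed simp
  also have "\<dots> = (\<Sum>j\<in>{1..N}. if conjugate l (j - 1) - conjugate m (j - 1) = 1 then 1 else 0)"
    by (rule sum.reindex_bij_witness[of _ "\<lambda>j. j - 1" Suc]) auto
  also have "\<dots> = card {j \<in> {1..N}. conjugate l (j - 1) - conjugate m (j - 1) = 1}"
    by (simp add: sum.If_cases Int_def)
  finally show ?thesis .
qed

text \<open>Among rows of \<open>m\<close> of equal length only the last can exceed the next row of
  \<open>l\<close>, because \<open>m (Suc i) \<le> l (Suc i)\<close>. So sending a counted row to
  its length is injective, and its image is the set of sites on the right.\<close>

lemma nonempty_rows_bar_horizontal_strip: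
  assumes l: "is_partition l" and m: "is_partition m" and hs: "horizontal_strip l m" and N: "l 0 \<le> N"
  shows "nonempty_rows m (bar l) =
    card {j \<in> {1..N}. conjugate l (j - 1) - conjugate m (j - 1) \<noteq> 1 \<and> part_mult m j \<noteq> 0}"
proof -
  have strip: "m i \<le> l i" "l (Suc i) \<le> m i" for i using hs by (auto simp: horizontal_strip_def)
  have c: "conjugate m j \<le> conjugate l j" "conjugate l j \<le> Suc (conjugate m j)" for j
    using horizontal_strip_iff_conjugate[OF l m] hs by auto
  let ?A = "{i. l (Suc i) < m i}"
  let ?B = "{j \<in> {1..N}. conjugate l (j - 1) - conjugate m (j - 1) \<noteq> 1 \<and> part_mult m j \<noteq> 0}"
  \<comment> \<open>The column through the last cell of row \<open>i\<close> ends at that row in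
    both diagrams: its length is at least \<open>Suc i\<close> in \<open>m\<close>, at most
    \<open>Suc i\<close> in \<open>l\<close>, and \<open>c\<close> orders the two.\<close>
  have cm: "conjugate m (m i - 1) = Suc i \<and> conjugate l (m i - 1) = Suc i \<and> conjugate m (m i) \<le> i"
    if "i \<in> ?A" for i
  proof -
    have "i < conjugate m (m i - 1)" using that by (simp add: less_conjugate_iff[OF m])
    moreover have "\<not> Suc i < conjugate l (m i - 1)" using that by (simp add: less_conjugate_iff[OF l])
    moreover have "\<not> i < conjugate m (m i)" by (simp add: less_conjugate_iff[OF m])
    ultimately show ?thesis using c[of "m i - 1"] by linarith
  qed
  have "bij_betw m ?A ?B"
  \<comment> \<open>The inverse picks the last row of \<open>m\<close> that meets column
    \<open>j - 1\<close>.\<close>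
  proof (rule bij_betw_byWitness[where f' = "\<lambda>j. conjugate m (j - 1) - 1"])
    show "\<forall>i\<in>?A. conjugate m (m i - 1) - 1 = i" using cm by simp
    show "m ` ?A \<subseteq> ?B"
    proof clarify
      fix i assume i: "l (Suc i) < m i"
      have "m i \<le> N" using strip(1)[of i] is_partition_antimonoD[OF l, of 0 i] N by simp
      moreover have "part_mult m (m i) \<noteq> 0"
        using cm[of i] i conjugate_eq_part_mult_plus[OF m, of "m i - 1"] by auto
      ultimately show "m i \<in> {1..N} \<and> conjugate l (m i - 1) - conjugate m (m i - 1) \<noteq> 1 \<and> part_mult m (m i) \<noteq> 0"
        using i cm[of i] by auto
    qed
    \<comment> \<open>Column \<open>j - 1\<close> has equal length in \<open>l\<close> and
      \<open>m\<close>, so row \<open>Suc ?i\<close> of \<open>l\<close> misses it. Positive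
      multiplicity makes column \<open>j\<close> of \<open>m\<close> shorter, so row
      \<open>?i\<close> of \<open>m\<close> has length exactly \<open>j\<close>.\<close>
    have B: "m (conjugate m (j - 1) - 1) = j \<and> l (Suc (conjugate m (j - 1) - 1)) < j" if j: "j \<in> ?B" for j
    proof -
      let ?i = "conjugate m (j - 1) - 1"
      have pos: "conjugate m (j - 1) \<noteq> 0" "conjugate m j < conjugate m (j - 1)"
        using conjugate_eq_part_mult_plus[OF m, of "j - 1"] j by auto
      have "j - 1 < m ?i" using pos by (simp flip: less_conjugate_iff[OF m])
      moreover have "\<not> j < m ?i" using pos by (simp flip: less_conjugate_iff[OF m])
      moreover have "\<not> j - 1 < l (Suc ?i)"
        unfolding less_conjugate_iff[OF l, symmetric] using pos c[of "j - 1"] j by simp linarith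
      moreover have "j \<ge> 1" using j by auto
      ultimately show ?thesis by linarith
    qed
    then show "\<forall>j\<in>?B. m (conjugate m (j - 1) - 1) = j" by blast
    show "(\<lambda>j. conjugate m (j - 1) - 1) ` ?B \<subseteq> ?A" using B by (metis (mono_tags, lifting) image_subsetI mem_Collect_eq)
  qed
  from bij_betw_same_card[OF this] show ?thesis by (simp add: nonempty_rows_def bar_def)
qed

subsection \<open>Rows of the lattice\<close>

text \<open>Indexed like \<open>h k\<close>: the value at \<open>j\<close> is the right label of
  site \<open>j\<close> and the left label of site \<open>Suc j\<close>. The truncated subtraction
  is exact when \<open>m\<close> is contained in \<open>l\<close>.\<close>

definition strip_label :: "(nat \<Rightarrow> nat) \<Rightarrow> (nat \<Rightarrow> nat) \<Rightarrow> nat \<Rightarrow> nat" where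
  "strip_label l m j = conjugate l j - conjugate m j"

lemma strip_label_conservation:
  assumes "is_partition l" "is_partition m" "horizontal_strip l m" "j \<ge> 1"
  shows "strip_label l m (j - 1) + part_mult m j = strip_label l m j + part_mult l j"
proof -
  obtain i where "j = Suc i" using assms(4) by (cases j) auto
  moreover have "conjugate m i \<le> conjugate l i" "conjugate m (Suc i) \<le> conjugate l (Suc i)"
    using assms horizontal_strip_iff_conjugate by blast+
  ultimately show ?thesis
    using conjugate_eq_part_mult_plus[OF assms(1), of i] conjugate_eq_part_mult_plus[OF assms(2), of i]
    unfolding strip_label_def by simp
qed

lemma strip_label_01:
  assumes "is_partition l" "is_partition m" "horizontal_strip l m"
  shows "strip_label l m j \<in> {0, 1}"
proof -
  have "conjugate l j \<le> Suc (conjugate m j)" using assms horizontal_strip_iff_conjugate by blast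
  then show ?thesis by (auto simp: strip_label_def)
qed

lemma strip_label_eq_0: "is_partition l \<Longrightarrow> l 0 \<le> j \<Longrightarrow> strip_label l m j = 0"
  by (simp add: strip_label_def conjugate_eq_0)

text \<open>The only candidate for the conjugate of \<open>m\<close> is \<open>conjugate l\<close>
  minus \<open>h\<close>. Conservation makes the bottom labels its successive differences, so it
  decreases and \<open>m\<close> has the required multiplicities.\<close>

lemma row_obtains_horizontal_strip:
  assumes l: "is_partition l" and h01: "\<And>j. h j \<in> {0, 1::nat}" and right: "\<forall>j\<ge>J. h j = 0"
    and cons: "\<And>j. j \<ge> 1 \<Longrightarrow> h (j - 1) + b j = h j + part_mult l j"
  obtains m where "is_partition m" "horizontal_strip l m" "h = strip_label l m"
    "\<And>j. j \<ge> 1 \<Longrightarrow> part_mult m j = b j"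
proof -
  have step: "h j + b (Suc j) = h (Suc j) + part_mult l (Suc j)" for j using cons[of "Suc j"] by simp
  note cl = conjugate_eq_part_mult_plus[OF l]
  \<comment> \<open>Downward induction from \<open>J\<close>, where \<open>h\<close> vanishes; the
    bound makes the subtraction in \<open>c\<close> exact.\<close>
  have h_le: "h j \<le> conjugate l j" for j
  proof (cases "j \<le> J")
    case True
    then show ?thesis
    proof (induction rule: inc_induct)
      case (step j)
      then show ?case using \<open>\<And>j. h j + b (Suc j) = _\<close>[of j] cl[of j] by linarith
    qed (use right in simp)
  qed (use right in simp)
  define c where "c j = conjugate l j - h j" for j
  have c: "c j = b (Suc j) + c (Suc j)" for j
    using step[of j] cl[of j] h_le[of j] h_le[of "Suc j"] by (simp add: c_def)
  have "antimono c" unfolding antimono_iff_le_Suc using c by (metis le_add2)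
  moreover have "{j. c j \<noteq> 0} \<subseteq> {j. conjugate l j \<noteq> 0}" by (auto simp: c_def)
  ultimately have cp: "is_partition c"
    using is_partition_conjugate[OF l] finite_subset unfolding is_partition_def by blast
  define m where "m = conjugate c"
  have m: "is_partition m" using cp by (simp add: m_def is_partition_conjugate)
  have cm: "conjugate m = c" using cp by (simp add: m_def conjugate_conjugate)
  have "horizontal_strip l m"
    unfolding horizontal_strip_iff_conjugate[OF l m] cm c_def
  proof
    fix j show "conjugate l j - h j \<le> conjugate l j \<and> conjugate l j \<le> Suc (conjugate l j - h j)"
      using h01[of j] by auto
  qed
  moreover have "h = strip_label l m" using h_le by (simp add: fun_eq_iff strip_label_def cm c_def)
  moreover have "part_mult m j = b j" if "j \<ge> 1" for j
    using conjugate_eq_part_mult_plus[OF m, of "j - 1"] c[of "j - 1"] that by (simp add: cm)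
  ultimately show ?thesis using that m by blast
qed

text \<open>The first exponent counts the sites with left label 1, the second those with left label
  0 and nonzero bottom label. All other sites have weight 1.\<close>

lemma prod_row_weight:
  fixes \<alpha> \<beta> y :: "'a::field"
  assumes l: "is_partition l" and m: "is_partition m" and hs: "horizontal_strip l m"
  defines "wt \<equiv> \<lambda>j. vertex_weight \<alpha> \<beta> y (strip_label l m (j - 1)) (part_mult m j)
                      (strip_label l m j) (part_mult l j)"
  shows "finite {j \<in> {1..}. wt j \<noteq> 1}"
    and "(\<Prod>j | j \<in> {1..} \<and> wt j \<noteq> 1. wt j) =
      (y / (1 - \<alpha> * y)) ^ (psize l - psize m) * ((1 + \<beta> * y) / (1 - \<alpha> * y)) ^ nonempty_rows m (bar l)"
proof -
  let ?u = "y / (1 - \<alpha> * y)" and ?t = "(1 + \<beta> * y) / (1 - \<alpha> * y)"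
  let ?A = "{j \<in> {1..l 0}. strip_label l m (j - 1) = 1}"
  let ?B = "{j \<in> {1..l 0}. strip_label l m (j - 1) \<noteq> 1 \<and> part_mult m j \<noteq> 0}"
  \<comment> \<open>If the left and bottom labels are 0, conservation forces the other two to be 0.
    So for left label 0 only the bottom label decides the weight.\<close>
  have wt: "wt j = (if strip_label l m (j - 1) = 1 then ?u else 1) *
      (if strip_label l m (j - 1) \<noteq> 1 \<and> part_mult m j \<noteq> 0 then ?t else 1)" if "j \<ge> 1" for j
    using strip_label_conservation[OF l m hs that] strip_label_01[OF l m hs, of "j - 1"]
    by (auto simp: wt_def vertex_weight_def)
  have m0: "m 0 \<le> l 0" using hs by (auto simp: horizontal_strip_def)
  have sub: "{j \<in> {1..}. wt j \<noteq> 1} \<subseteq> {1..l 0}"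
  proof (rule ccontr)
    assume "\<not> ?thesis"
    then obtain j where j: "j \<ge> 1" "wt j \<noteq> 1" "l 0 < j" by (auto simp: subset_iff not_le)
    moreover have "part_mult m j = 0" using part_mult_eq_0[OF m, of "j - 1"] j m0 by simp
    moreover have "strip_label l m (j - 1) = 0" using strip_label_eq_0[OF l] j by simp
    ultimately show False using wt[of j] by simp
  qed
  then show "finite {j \<in> {1..}. wt j \<noteq> 1}" by (rule finite_subset) simp
  have "(\<Prod>j | j \<in> {1..} \<and> wt j \<noteq> 1. wt j) = (\<Prod>j\<in>{1..l 0}. wt j)"
    using sub by (intro prod.mono_neutral_left) auto
  also have "\<dots> = (\<Prod>j\<in>{1..l 0}. (if strip_label l m (j - 1) = 1 then ?u else 1)) *
      (\<Prod>j\<in>{1..l 0}. (if strip_label l m (j - 1) \<noteq> 1 \<and> part_mult m j \<noteq> 0 then ?t else 1))"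
    by (subst prod.distrib[symmetric]) (rule prod.cong, use wt in auto)
  also have "\<dots> = ?u ^ card ?A * ?t ^ card ?B"
    by (simp add: prod.If_cases Int_def)
  finally show "(\<Prod>j | j \<in> {1..} \<and> wt j \<noteq> 1. wt j) = ?u ^ (psize l - psize m) * ?t ^ nonempty_rows m (bar l)"
    by (simp add: psize_diff_horizontal_strip[OF l m hs order_refl]
        nonempty_rows_bar_horizontal_strip[OF l m hs order_refl] strip_label_def)
qed

subsection \<open>Splitting off the top row\<close>

text \<open>Selecting by conservation instead of nonzero weight gives an index set independent of
  the parameters; a conserving labeling may still have weight 0.\<close>

definition conserving ::
  "nat \<Rightarrow> (nat \<Rightarrow> nat) \<Rightarrow> ((nat \<Rightarrow> nat \<Rightarrow> nat) \<times> (nat \<Rightarrow> nat \<Rightarrow> nat)) set" where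
  "conserving n l = {(h, v). (h, v) \<in> labelings n (\<lambda>_. 0) (part_mult l) 0 \<and>
     (\<forall>k\<in>{1..n}. \<forall>j\<ge>1. h k (j - 1) + v (k - 1) j = h k j + v k j)}"

definition add_row :: "nat \<Rightarrow> (nat \<Rightarrow> nat) \<Rightarrow>
    (nat \<Rightarrow> nat) \<times> (nat \<Rightarrow> nat \<Rightarrow> nat) \<times> (nat \<Rightarrow> nat \<Rightarrow> nat) \<Rightarrow> (nat \<Rightarrow> nat \<Rightarrow> nat) \<times> (nat \<Rightarrow> nat \<Rightarrow> nat)" where
  "add_row n l = (\<lambda>(m, h, v). (h(Suc n := strip_label l m), v(Suc n := restrict (part_mult l) {1..})))"

text \<open>An infinite index set gives the default 0. Otherwise a violating vertex, having weight 0
  and hence not 1, is among the factors.\<close>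

lemma labeling_weight_eq_0:
  assumes "(h, v) \<in> labelings n (\<lambda>_. 0) (part_mult l) 0" "(h, v) \<notin> conserving n l"
  shows "labeling_weight (vertex_weight \<alpha> \<beta>) y n (h, v) = 0"
proof -
  obtain k j where *: "k \<in> {1..n}" "j \<ge> 1" "h k (j - 1) + v (k - 1) j \<noteq> h k j + v k j"
    using assms by (auto simp: conserving_def)
  define wt where "wt = (\<lambda>(k, j). vertex_weight \<alpha> \<beta> (y k) (h k (j - 1)) (v (k - 1) j) (h k j) (v k j))"
  from * have "(k, j) \<in> {1..n} \<times> {1..}"
    "vertex_weight \<alpha> \<beta> (y k) (h k (j - 1)) (v (k - 1) j) (h k j) (v k j) = 0"
    by (auto simp: vertex_weight_def)
  then have "\<exists>p\<in>{p \<in> {1..n} \<times> {1..}. wt p \<noteq> 1}. wt p = 0"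
    by (intro bexI[of _ "(k, j)"]) (simp_all add: wt_def)
  then show ?thesis
    unfolding labeling_weight_def Let_def prod.case wt_def[symmetric] by (auto intro!: prod_zero)
qed

lemma labeling_weight_add_row:
  fixes \<alpha> \<beta> :: "'a::field"
  assumes l: "is_partition l" and m: "is_partition m" and hs: "horizontal_strip l m"
    and hv: "(h, v) \<in> labelings n (\<lambda>_. 0) (part_mult m) 0"
  shows "labeling_weight (vertex_weight \<alpha> \<beta>) y (Suc n) (add_row n l (m, h, v)) =
    labeling_weight (vertex_weight \<alpha> \<beta>) y n (h, v) *
    (y (Suc n) / (1 - \<alpha> * y (Suc n))) ^ (psize l - psize m) *
    ((1 + \<beta> * y (Suc n)) / (1 - \<alpha> * y (Suc n))) ^ nonempty_rows m (bar l)"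
proof -
  let ?h = "h(Suc n := strip_label l m)" and ?v = "v(Suc n := restrict (part_mult l) {1..})"
  define wt where "wt = (\<lambda>(k, j). vertex_weight \<alpha> \<beta> (y k) (h k (j - 1)) (v (k - 1) j) (h k j) (v k j))"
  define wt' where "wt' = (\<lambda>(k, j). vertex_weight \<alpha> \<beta> (y k) (?h k (j - 1)) (?v (k - 1) j) (?h k j) (?v k j))"
  define row where "row = (\<lambda>j. vertex_weight \<alpha> \<beta> (y (Suc n)) (strip_label l m (j - 1)) (part_mult m j)
                      (strip_label l m j) (part_mult l j))"
  define S where "S = {p \<in> {1..n} \<times> {1..}. wt p \<noteq> 1}"
  define S' where "S' = {p \<in> {1..Suc n} \<times> {1..}. wt' p \<noteq> 1}"
  define R where "R = {j \<in> {1..}. row j \<noteq> 1}"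
  have R: "finite R" "prod row R = (y (Suc n) / (1 - \<alpha> * y (Suc n))) ^ (psize l - psize m) *
      ((1 + \<beta> * y (Suc n)) / (1 - \<alpha> * y (Suc n))) ^ nonempty_rows m (bar l)"
    unfolding R_def row_def by (rule prod_row_weight[OF l m hs])+
  have old: "wt' p = wt p" if "p \<in> {1..n} \<times> {1..}" for p
    using that by (auto simp: wt_def wt'_def)
  \<comment> \<open>By \<open>hv\<close> the top labels of row \<open>n\<close> are the
    multiplicities of \<open>m\<close>; they are the bottom labels of the new row.\<close>
  have new: "wt' (Suc n, j) = row j" if "j \<ge> 1" for j
    using that hv by (auto simp: wt'_def row_def labelings_def)
  have S': "S' = S \<union> Pair (Suc n) ` R"
  proof (intro set_eqI)
    fix p :: "nat \<times> nat" obtain k j where p: "p = (k, j)" by force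
    show "p \<in> S' \<longleftrightarrow> p \<in> S \<union> Pair (Suc n) ` R"
      unfolding p S'_def S_def R_def using old[of "(k, j)"] new[of j]
      by (cases "k = Suc n") (auto simp: le_Suc_eq)
  qed
  have "labeling_weight (vertex_weight \<alpha> \<beta>) y (Suc n) (add_row n l (m, h, v)) =
      (if finite S' then prod wt' S' else 0)"
    by (simp add: labeling_weight_def add_row_def wt'_def S'_def Let_def)
  also have "\<dots> = (if finite S then prod wt S else 0) * prod row R"
  \<comment> \<open>Since \<open>R\<close> is finite, \<open>S\<close> and \<open>S'\<close> are
    finite together; if they are infinite, both sides are the default 0.\<close>
  proof (cases "finite S")
    case True
    have "S \<inter> Pair (Suc n) ` R = {}" by (auto simp: S_def)
    then have "prod wt' S' = prod wt' S * prod wt' (Pair (Suc n) ` R)"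
      unfolding S' using True R(1) by (intro prod.union_disjoint) auto
    also have "prod wt' S = prod wt S" by (rule prod.cong) (auto simp: S_def intro!: old)
    also have "prod wt' (Pair (Suc n) ` R) = prod row R"
      by (subst prod.reindex) (auto simp: inj_on_def R_def intro!: prod.cong new)
    finally show ?thesis using True R(1) S' by simp
  qed (simp add: S')
  also have "(if finite S then prod wt S else 0) = labeling_weight (vertex_weight \<alpha> \<beta>) y n (h, v)"
    by (simp add: labeling_weight_def wt_def S_def Let_def)
  finally show ?thesis by (simp add: R(2) mult.assoc)
qed

lemma add_row_conserving:
  assumes l: "is_partition l" and m: "is_partition m" and hs: "horizontal_strip l m"
    and hv: "(h, v) \<in> conserving n m"
  shows "add_row n l (m, h, v) \<in> conserving (Suc n) l"
proof -
  let ?h = "h(Suc n := strip_label l m)" and ?v = "v(Suc n := restrict (part_mult l) {1..})"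
  have hv': "h \<in> {1..n} \<rightarrow>\<^sub>E (UNIV \<rightarrow> {0, 1})" "v \<in> {0..n} \<rightarrow>\<^sub>E ({1..} \<rightarrow>\<^sub>E UNIV)"
     "\<forall>j\<ge>1. v 0 j = 0" "\<forall>j\<ge>1. v n j = part_mult m j" "\<forall>k\<in>{1..n}. \<exists>J. \<forall>j\<ge>J. h k j = 0"
     "\<forall>k\<in>{1..n}. \<forall>j\<ge>1. h k (j - 1) + v (k - 1) j = h k j + v k j"
    using hv by (auto simp: conserving_def labelings_def)
  have ins: "insert (Suc n) {1..n} = {1..Suc n}" "insert (Suc n) {0..n} = {0..Suc n}" by auto
  have h: "?h \<in> {1..Suc n} \<rightarrow>\<^sub>E (UNIV \<rightarrow> {0, 1})"
    unfolding ins(1)[symmetric] by (rule PiE_fun_upd) (use strip_label_01[OF l m hs] hv' in auto)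
  have v: "?v \<in> {0..Suc n} \<rightarrow>\<^sub>E ({1..} \<rightarrow>\<^sub>E UNIV)"
    unfolding ins(2)[symmetric] by (rule PiE_fun_upd) (use hv' in auto)
  have bd: "\<forall>j\<ge>1. ?v 0 j = 0" "\<forall>j\<ge>1. ?v (Suc n) j = part_mult l j" using hv'(3) by auto
  have right: "\<forall>k\<in>{1..Suc n}. \<exists>J. \<forall>j\<ge>J. ?h k j = 0"
  proof
    fix k assume "k \<in> {1..Suc n}"
    then show "\<exists>J. \<forall>j\<ge>J. ?h k j = 0"
      using hv'(5) strip_label_eq_0[OF l, of _ m] by (cases "k = Suc n") (auto intro: exI[of _ "l 0"])
  qed
  have cons: "\<forall>k\<in>{1..Suc n}. \<forall>j\<ge>1. ?h k (j - 1) + ?v (k - 1) j = ?h k j + ?v k j"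
  proof (intro ballI allI impI)
    fix k j :: nat assume "k \<in> {1..Suc n}" "j \<ge> 1"
    then show "?h k (j - 1) + ?v (k - 1) j = ?h k j + ?v k j"
      using hv'(4,6) strip_label_conservation[OF l m hs] by (cases "k = Suc n") auto
  qed
  show ?thesis
    unfolding conserving_def labelings_def add_row_def prod.case mem_Collect_eq
    by (intro conjI h v bd right cons)
qed

text \<open>The top row of a conserving labeling determines \<open>m\<close>, and the rows below it
  form a conserving labeling with top boundary given by \<open>m\<close>.\<close>

lemma bij_betw_add_row:
  assumes l: "is_partition l"
  shows "bij_betw (add_row n l) (SIGMA m:{m. is_partition m \<and> horizontal_strip l m}. conserving n m)
    (conserving (Suc n) l)" (is "bij_betw _ ?A ?B")
proof -
  \<comment> \<open>Index \<open>Suc n\<close> lies outside the domain of an \<open>n\<close>-row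
    labeling, so resetting it to \<open>undefined\<close> undoes \<open>add_row\<close>.\<close>
  have ext: "h (Suc n) = undefined" "v (Suc n) = undefined" if "(h, v) \<in> conserving n m" for h v m
    using that by (auto simp: conserving_def labelings_def PiE_def extensional_def)
  have "inj_on (add_row n l) ?A"
  proof (rule inj_onI, clarify)
    fix m h v m' h' v'
    assume m: "is_partition m" "horizontal_strip l m" and m': "is_partition m'" "horizontal_strip l m'"
      and hv: "(h, v) \<in> conserving n m" "(h', v') \<in> conserving n m'"
      and eq: "add_row n l (m, h, v) = add_row n l (m', h', v')"
    have upd: "h(Suc n := strip_label l m) = h'(Suc n := strip_label l m')"
        "v(Suc n := restrict (part_mult l) {1..}) = v'(Suc n := restrict (part_mult l) {1..})"
      using eq by (auto simp: add_row_def)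
    have "h = h'" "v = v'"
      using arg_cong[OF upd(1), of "\<lambda>f. f(Suc n := undefined)"]
        arg_cong[OF upd(2), of "\<lambda>f. f(Suc n := undefined)"] ext[OF hv(1)] ext[OF hv(2)]
      by (metis fun_upd_triv fun_upd_upd)+
    moreover have "strip_label l m = strip_label l m'" using fun_cong[OF upd(1), of "Suc n"] by simp
    then have "conjugate m = conjugate m'"
      using m m' l horizontal_strip_iff_conjugate
      by (auto simp: strip_label_def fun_eq_iff) (metis diff_diff_cancel)
    then have "m = m'" using m m' conjugate_inject by blast
    ultimately show "m = m' \<and> (h, v) = (h', v')" by blast
  qed
  moreover have "add_row n l ` ?A \<subseteq> ?B" using add_row_conserving[OF l] by auto
  moreover have "?B \<subseteq> add_row n l ` ?A"
  proof clarify
    fix h v assume hv: "(h, v) \<in> conserving (Suc n) l"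
    have hv': "h \<in> {1..Suc n} \<rightarrow>\<^sub>E (UNIV \<rightarrow> {0, 1})" "v \<in> {0..Suc n} \<rightarrow>\<^sub>E ({1..} \<rightarrow>\<^sub>E UNIV)"
      "\<forall>j\<ge>1. v 0 j = 0" "\<forall>j\<ge>1. v (Suc n) j = part_mult l j" "\<forall>k\<in>{1..Suc n}. \<exists>J. \<forall>j\<ge>J. h k j = 0"
      "\<forall>k\<in>{1..Suc n}. \<forall>j\<ge>1. h k (j - 1) + v (k - 1) j = h k j + v k j"
      using hv by (auto simp: conserving_def labelings_def)
    obtain J where J: "\<forall>j\<ge>J. h (Suc n) j = 0" using hv'(5)[rule_format, of "Suc n"] by auto
    have h01: "h (Suc n) j \<in> {0, 1}" for j using hv'(1) by (auto simp: PiE_iff Pi_iff)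
    have "h (Suc n) (j - 1) + v n j = h (Suc n) j + part_mult l j" if "j \<ge> 1" for j
      using hv'(4) hv'(6)[rule_format, of "Suc n" j] that by auto
    from row_obtains_horizontal_strip[OF l h01 J this]
    obtain m where m: "is_partition m" "horizontal_strip l m" "h (Suc n) = strip_label l m"
      "\<And>j. j \<ge> 1 \<Longrightarrow> part_mult m j = v n j" by blast
    have "v (Suc n) = restrict (part_mult l) {1..}"
      using hv'(2,4) by (auto simp: PiE_iff fun_eq_iff extensional_def restrict_def)
    then have "(h, v) = add_row n l (m, h(Suc n := undefined), v(Suc n := undefined))"
      using m(3) by (simp add: add_row_def fun_upd_idem)
    moreover have "(h(Suc n := undefined), v(Suc n := undefined)) \<in> conserving n m"
    proof -
      have "h(Suc n := undefined) \<in> {1..n} \<rightarrow>\<^sub>E (UNIV \<rightarrow> {0, 1})"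
        "v(Suc n := undefined) \<in> {0..n} \<rightarrow>\<^sub>E ({1..} \<rightarrow>\<^sub>E UNIV)"
        using hv'(1,2) by (auto simp: PiE_iff extensional_def le_Suc_eq)
      then show ?thesis using hv'(3,5,6) m(4) by (auto simp: conserving_def labelings_def)
    qed
    ultimately show "(h, v) \<in> add_row n l ` ?A" using m(1,2) by blast
  qed
  ultimately show ?thesis by (auto simp: bij_betw_def)
qed

section \<open>Base case, finiteness and induction on the number of rows\<close>

lemma conserving_0:
  assumes "is_partition l"
  shows "conserving 0 l =
    (if l = (\<lambda>_. 0) then {(\<lambda>_. undefined, (\<lambda>_. undefined)(0 := restrict (\<lambda>_. 0) {1..}))} else {})"
proof (cases "l = (\<lambda>_. 0)")
  case True
  then have "part_mult (\<lambda>_. 0) j = 0" if "j \<ge> 1" for j using that by (auto simp: part_mult_def)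
  then show ?thesis unfolding True
    by (auto simp: conserving_def labelings_def PiE_iff extensional_def fun_eq_iff restrict_def)
next
  case False
  then obtain i where i: "l i \<noteq> 0" by auto
  \<comment> \<open>Without finiteness \<open>card\<close> would return 0. A nonzero multiplicity
    contradicts the zero boundary, since \<open>v 0\<close> is both bottom and top.\<close>
  have "finite {k. l k = l i}"
    by (rule finite_subset[OF _ finite_parts_greater[OF assms, of 0]]) (use i in auto)
  then have "part_mult l (l i) \<noteq> 0" by (auto simp: part_mult_def)
  moreover have "l i \<ge> 1" using i by simp
  ultimately have "conserving 0 l = {}" by (auto simp: conserving_def labelings_def)
  then show ?thesis using False by simp
qed

lemma finite_conserving: "is_partition l \<Longrightarrow> finite (conserving n l)"
proof (induction n arbitrary: l)
  case 0
  then show ?case by (simp add: conserving_0)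
next
  case (Suc n)
  have "finite (SIGMA m:{m. is_partition m \<and> horizontal_strip l m}. conserving n m)"
    using Suc by (intro finite_SigmaI finite_horizontal_strips) auto
  then show ?case using bij_betw_finite[OF bij_betw_add_row[OF Suc.prems]] by simp
qed

lemma lattice_Z_eq_sum_conserving:
  assumes "is_partition l"
  shows "lattice_Z \<alpha> \<beta> x n l = (\<Sum>s\<in>conserving n l. labeling_weight (vertex_weight \<alpha> \<beta>) x n s)"
  unfolding lattice_Z_def partition_function_def
proof (rule sum.mono_neutral_left[OF finite_conserving[OF assms]])
  show "{s \<in> labelings n (\<lambda>_. 0) (part_mult l) 0. labeling_weight (vertex_weight \<alpha> \<beta>) x n s \<noteq> 0}
      \<subseteq> conserving n l"
    using labeling_weight_eq_0 by fastforce
qed (auto simp: conserving_def)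

text \<open>The bijection \<open>add_row\<close> splits the sum into one over \<open>m\<close> and
  one over \<open>n\<close>-row labelings; the factor of the top row is the branching
  coefficient.\<close>

theorem grothendieck_eq_lattice_Z:
  "is_partition l \<Longrightarrow> grothendieck \<alpha> \<beta> x n l = lattice_Z \<alpha> \<beta> x n l"
proof (induction n arbitrary: l)
  case 0
  then show ?case
    by (simp add: lattice_Z_eq_sum_conserving conserving_0 labeling_weight_def)
next
  case (Suc n)
  let ?M = "{m. is_partition m \<and> horizontal_strip l m}"
  let ?w = "labeling_weight (vertex_weight \<alpha> \<beta>) x"
  let ?r = "\<lambda>m. (x (Suc n) / (1 - \<alpha> * x (Suc n))) ^ (psize l - psize m) *
    ((1 + \<beta> * x (Suc n)) / (1 - \<alpha> * x (Suc n))) ^ nonempty_rows m (bar l)"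
  have "lattice_Z \<alpha> \<beta> x (Suc n) l = (\<Sum>s\<in>conserving (Suc n) l. ?w (Suc n) s)"
    by (rule lattice_Z_eq_sum_conserving[OF Suc.prems])
  also have "\<dots> = (\<Sum>p\<in>(SIGMA m:?M. conserving n m). ?w (Suc n) (add_row n l p))"
    by (rule sum.reindex_bij_betw[OF bij_betw_add_row[OF Suc.prems], symmetric])
  also have "\<dots> = (\<Sum>(m, s)\<in>(SIGMA m:?M. conserving n m). ?w n s * ?r m)"
  proof (rule sum.cong[OF refl], clarify)
    fix m h v assume "is_partition m" "horizontal_strip l m" "(h, v) \<in> conserving n m"
    then show "?w (Suc n) (add_row n l (m, h, v)) = ?w n (h, v) * ?r m"
      using labeling_weight_add_row[OF Suc.prems, of m h v n \<alpha> \<beta> x]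
      by (simp add: conserving_def mult.assoc)
  qed
  also have "\<dots> = (\<Sum>m\<in>?M. \<Sum>s\<in>conserving n m. ?w n s * ?r m)"
    by (rule sum.Sigma[symmetric]) (auto intro: finite_horizontal_strips[OF Suc.prems] finite_conserving)
  also have "\<dots> = (\<Sum>m\<in>?M. grothendieck \<alpha> \<beta> x n m * ?r m)"
    by (rule sum.cong) (simp_all add: Suc.IH lattice_Z_eq_sum_conserving sum_distrib_right)
  finally show ?case by (simp add: mult.assoc)
qed

subsection \<open>The dual model\<close>

text \<open>Rows run over 1..n, so row \<open>k\<close> goes to \<open>n + 1 - k\<close>; vertical
  levels run over 0..n, so level \<open>k\<close> goes to \<open>n - k\<close>.\<close>

definition flip :: "nat \<Rightarrow> (nat \<Rightarrow> nat \<Rightarrow> nat) \<times> (nat \<Rightarrow> nat \<Rightarrow> nat) \<Rightarrow>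
    (nat \<Rightarrow> nat \<Rightarrow> nat) \<times> (nat \<Rightarrow> nat \<Rightarrow> nat)" where
  "flip n = (\<lambda>(h, v). (restrict (\<lambda>k j. 1 - h (n + 1 - k) j) {1..n}, restrict (\<lambda>k. v (n - k)) {0..n}))"

text \<open>Conservation becomes (1 - a) + d = (1 - c) + b, and the exceptional vertex
  \<open>(1, 0, 1, 0)\<close> becomes \<open>(0, 0, 0, 0)\<close>.\<close>

lemma dual_vertex_weight_eq:
  "a \<in> {0, 1} \<Longrightarrow> c \<in> {0, 1} \<Longrightarrow>
    dual_vertex_weight \<alpha> \<beta> x a b c d = vertex_weight \<alpha> \<beta> x (1 - a) d (1 - c) b"
  by (auto simp: dual_vertex_weight_def vertex_weight_def)

lemma flip_labelings:
  assumes "s \<in> labelings n b t r" "r \<in> {0, 1}"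
  shows "flip n s \<in> labelings n t b (1 - r)"
proof -
  obtain h v where s: "s = (h, v)" by force
  have "\<exists>J. \<forall>j\<ge>J. Suc 0 - h (Suc n - k) j = Suc 0 - r" if k: "k \<in> {1..n}" for k
  proof -
    have "Suc n - k \<in> {1..n}" using k by auto
    moreover have "\<forall>k\<in>{1..n}. \<exists>J. \<forall>j\<ge>J. h k j = r" using assms(1) by (simp add: s labelings_def)
    ultimately obtain J where "\<forall>j\<ge>J. h (Suc n - k) j = r" by blast
    then show ?thesis by auto
  qed
  then show ?thesis using assms by (auto simp: s labelings_def flip_def PiE_iff extensional_def)
qed

lemma flip_flip:
  assumes "s \<in> labelings n b t r"
  shows "flip n (flip n s) = s"
proof -
  obtain h v where s: "s = (h, v)" by force
  have h: "h \<in> {1..n} \<rightarrow>\<^sub>E (UNIV \<rightarrow> {0, 1})" and v: "v \<in> {0..n} \<rightarrow>\<^sub>E ({1..} \<rightarrow>\<^sub>E UNIV)"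
    using assms by (auto simp: s labelings_def)
  \<comment> \<open>With truncated subtraction, complementing twice is the identity only on labels 0
    and 1.\<close>
  have "1 - (1 - h k j) = h k j" if "k \<in> {1..n}" for k j
  proof -
    have "h k j \<in> {0, 1}" using h that by (auto simp: PiE_iff Pi_iff)
    then show ?thesis by auto
  qed
  then show ?thesis using h v
    by (auto simp: s flip_def fun_eq_iff restrict_def PiE_iff extensional_def)
qed

lemma labeling_weight_flip:
  assumes "s \<in> labelings n b t r"
  shows "labeling_weight (dual_vertex_weight \<alpha> \<beta>) (\<lambda>k. x (n + 1 - k)) n s =
    labeling_weight (vertex_weight \<alpha> \<beta>) x n (flip n s)"
proof -
  obtain h v where s: "s = (h, v)" by force
  obtain h' v' where s': "flip n s = (h', v')" by force
  define wt where "wt = (\<lambda>(k, j). dual_vertex_weight \<alpha> \<beta> (x (n + 1 - k)) (h k (j - 1)) (v (k - 1) j) (h k j) (v k j))"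
  define wt' where "wt' = (\<lambda>(k, j). vertex_weight \<alpha> \<beta> (x k) (h' k (j - 1)) (v' (k - 1) j) (h' k j) (v' k j))"
  define S where "S = {p \<in> {1..n} \<times> {1..}. wt p \<noteq> 1}"
  define S' where "S' = {p \<in> {1..n} \<times> {1..}. wt' p \<noteq> 1}"
  let ?f = "\<lambda>(k, j::nat). (n + 1 - k, j)"
  have h01: "h k j \<in> {0, 1}" if "k \<in> {1..n}" for k j
    using assms that by (auto simp: s labelings_def PiE_iff Pi_iff)
  have wt: "wt' (?f p) = wt p" if p: "p \<in> {1..n} \<times> {1..}" for p
  proof -
    obtain k j where kj: "p = (k, j)" "k \<in> {1..n}" "j \<ge> 1" using p by auto
    have "h' = restrict (\<lambda>k j. 1 - h (n + 1 - k) j) {1..n}" "v' = restrict (\<lambda>k. v (n - k)) {0..n}"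
      using s' by (auto simp: s flip_def)
    \<comment> \<open>The bottom level \<open>k - 1\<close> of row \<open>k\<close> becomes the top
      level of row \<open>n + 1 - k\<close>, and the top level \<open>k\<close> its bottom
      level.\<close>
    moreover have "n - (n + 1 - k) = k - 1" "n - (n + 1 - k - 1) = k" "n + 1 - (n + 1 - k) = k"
      "n + 1 - k \<in> {1..n}" "n + 1 - k \<in> {0..n}" "n + 1 - k - 1 \<in> {0..n}" using kj by auto
    ultimately show ?thesis
      unfolding kj(1) wt_def wt'_def prod.case
      by (subst dual_vertex_weight_eq[OF h01[OF kj(2)] h01[OF kj(2)]]) (simp only: restrict_apply if_True)
  qed
  have ff: "?f (?f p) = p" "?f p \<in> {1..n} \<times> {1..}" if "p \<in> {1..n} \<times> {1..}" for p using that by auto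
  have bij: "bij_betw ?f S S'"
  proof (rule bij_betw_byWitness[where f' = ?f])
    show "?f ` S \<subseteq> S'" using wt ff by (auto simp: S_def S'_def)
    show "?f ` S' \<subseteq> S"
    proof (rule image_subsetI)
      fix p assume "p \<in> S'"
      then show "?f p \<in> S" using wt[of "?f p"] ff[of p] unfolding S_def S'_def by auto
    qed
  qed (use ff in \<open>auto simp: S_def S'_def\<close>)
  have "prod wt S = prod wt' S'"
    unfolding prod.reindex_bij_betw[OF bij, symmetric] by (rule prod.cong) (use wt in \<open>auto simp: S_def\<close>)
  moreover have "finite S \<longleftrightarrow> finite S'" using bij by (rule bij_betw_finite)
  moreover have "labeling_weight (dual_vertex_weight \<alpha> \<beta>) (\<lambda>k. x (n + 1 - k)) n s = (if finite S then prod wt S else 0)"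
    by (simp add: labeling_weight_def s wt_def S_def Let_def)
  moreover have "labeling_weight (vertex_weight \<alpha> \<beta>) x n (flip n s) = (if finite S' then prod wt' S' else 0)"
    unfolding s' by (simp add: labeling_weight_def wt'_def S'_def Let_def)
  ultimately show ?thesis by simp
qed

text \<open>\<open>flip n\<close> is its own inverse on labelings, exchanges the boundary conditions
  and preserves weights, so it matches the labelings of nonzero weight.\<close>

theorem lattice_Z_dual_eq: "lattice_Z_dual \<alpha> \<beta> x n l = lattice_Z \<alpha> \<beta> x n l"
  unfolding lattice_Z_def lattice_Z_dual_def partition_function_def
proof (rule sum.reindex_bij_witness[of _ "flip n" "flip n"], goal_cases)
  case (1 s)
  then show ?case by (auto intro: flip_flip)
next
  case (2 s)
  then show ?case
    using flip_labelings[of s n _ _ 1] labeling_weight_flip[of s n _ _ _ \<alpha> \<beta> x] by auto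
next
  case (3 s)
  then show ?case by (auto intro: flip_flip)
next
  case (4 s)
  then have "flip n s \<in> labelings n (part_mult l) (\<lambda>_. 0) 1"
    using flip_labelings[of s n _ _ 0] by auto
  then show ?case
    using 4 labeling_weight_flip[of "flip n s" n _ _ _ \<alpha> \<beta> x] flip_flip[of s n] by auto
next
  case (5 s)
  then show ?case using labeling_weight_flip[of s n _ _ _ \<alpha> \<beta> x] by auto
qed

theorem theorem2p1:
  fixes \<alpha> \<beta> :: "'a::field" and x :: "nat \<Rightarrow> 'a" and n :: nat and l :: "nat \<Rightarrow> nat"
  assumes "n \<ge> 1"
    and "\<forall>i\<in>{1..n}. 1 - \<alpha> * x i \<noteq> 0"
    and "is_partition l"
  shows "grothendieck \<alpha> \<beta> x n l = lattice_Z \<alpha> \<beta> x n l \<and> lattice_Z \<alpha> \<beta> x n l = lattice_Z_dual \<alpha> \<beta> x n l"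
  using assms(3) by (simp add: grothendieck_eq_lattice_Z lattice_Z_dual_eq)

end
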